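(* Let $\gamma,\gamma'\in(0,1]$ with $\gamma'\le\gamma$, let $\lambda>0$ and $\kappa\in[0,1)$. Let $S_\gamma$ be a (positive) $\gamma$-stable random variable with Laplace transform $\mathrm{E}\,e^{-uS_\gamma}=\exp\{-u^\gamma\}$. Then $$\mathrm{SDS}(\gamma',\lambda,\kappa)\stackrel{d}{=}\mathrm{SDS}\left(\gamma'/\gamma,\ \lambda^{1/\gamma}S_\gamma,\ \kappa\right).$$
   Context: For $\gamma\in(0,1]$, $\lambda>0$, $\kappa\in[0,1)$, $\mathrm{SDS}(\gamma,\lambda,\kappa)$ (symmetric discrete stable) denotes the distribution on $\mathbb{Z}$ with probability generating function, for $|z|=1$, $$\mathcal{P}(z)=\sum_{k\in\mathbb{Z}}\mathbb{P}(X=k)z^k=\exp\left\{-\lambda\left(1-\frac{1-\kappa}{2}\left(\frac{z}{1-\kappa z}+\frac{z^{-1}}{1-\kappa z^{-1}}\right)\right)^{\gamma}\right\}.$$ When the parameter $\lambda$ is replaced by a positive random variable $\Lambda$, $\mathrm{SDS}(\gamma,\Lambda,\kappa)$ denotes the mixture: conditionally on $\Lambda=\ell$ the distribution is $\mathrm{SDS}(\gamma,\ell,\kappa)$. For $\gamma=1$, $S_1=1$ almost surely. *)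

theory Defs
  imports "HOL-Probability.Probability"
begin

text \<open>Probability generating function of a distribution on the integers. For norm z = 1
  the series converges absolutely.\<close>

definition pgf :: "int pmf \<Rightarrow> complex \<Rightarrow> complex" where
  "pgf p z = (\<Sum>\<^sub>\<infinity>k\<in>UNIV. complex_of_real (pmf p k) * z powi k)"

text \<open>For norm z = 1 and 0 \<le> \<kappa> < 1 the base of the power below is a nonnegative real number,
  so the principal branch chosen by complex \<open>powr\<close> is the ordinary real power (with value 0
  at z = 1).\<close>

definition SDS_gf :: "real \<Rightarrow> real \<Rightarrow> real \<Rightarrow> complex \<Rightarrow> complex" where
  "SDS_gf \<gamma> l \<kappa> z =
     exp (- complex_of_real l *
       (1 - complex_of_real ((1 - \<kappa>) / 2) *
          (z / (1 - complex_of_real \<kappa> * z) +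
           inverse z / (1 - complex_of_real \<kappa> * inverse z))) powr complex_of_real \<gamma>)"

definition SDS :: "real \<Rightarrow> real \<Rightarrow> real \<Rightarrow> int pmf" where
  "SDS \<gamma> l \<kappa> = (THE p. \<forall>z. norm z = 1 \<longrightarrow> pgf p z = SDS_gf \<gamma> l \<kappa> z)"

text \<open>The mixture with random scale parameter L, a random variable on the probability space M:
  the law obtained by drawing \<omega> from M and then an integer from \<open>SDS \<gamma> (L \<omega>) \<kappa>\<close>.\<close>

definition SDS_mix :: "'a measure \<Rightarrow> real \<Rightarrow> ('a \<Rightarrow> real) \<Rightarrow> real \<Rightarrow> int measure" where
  "SDS_mix M \<gamma> L \<kappa> = M \<bind> (\<lambda>\<omega>. measure_pmf (SDS \<gamma> (L \<omega>) \<kappa>))"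

end

theory Submission
  imports Defs
begin

text \<open>
  Put \<open>\<phi>(z) = (1 - \<kappa>)/2 * (z/(1 - \<kappa> z) + (1/z)/(1 - \<kappa>/z))\<close>. On the unit circle \<open>\<phi>\<close> is real and at
  most 1, and \<open>SDS \<gamma> l \<kappa>\<close> has generating function \<open>exp (- l * (1 - \<phi>) powr \<gamma>)\<close>. The generating
  function of a mixture is the mixture of the generating functions, so on the right-hand side it is
  \<open>E (exp (- u * S))\<close> with \<open>u = l powr (1/\<gamma>) * (1 - \<phi>) powr (\<gamma>'/\<gamma>)\<close>. The Laplace transform of \<open>S\<close>
  turns this into \<open>exp (- (u powr \<gamma>)) = exp (- l * (1 - \<phi>) powr \<gamma>')\<close>, and a law on the integers is
  determined by its generating function on the unit circle (\<open>int_measure_eqI\<close>, from Levy's uniqueness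
  theorem).

  Two points lie beneath this computation. First, \<open>SDS\<close> is a definite description, so a law with
  the prescribed generating function has to be exhibited. Here \<open>\<phi>\<close> is the generating function of a
  geometric variable with values in \<open>{1, 2, ...}\<close> and a random sign; \<open>1 - (1 - x) powr \<gamma>\<close> is, for
  \<open>\<gamma> \<in> (0, 1]\<close>, a power series with nonnegative coefficients of sum 1, namely the generating function
  of the Sibuya law; and \<open>exp(- l (1 - w))\<close> is that of the Poisson law. Composition of generating
  functions corresponds to random sums, so the desired law is a Poisson random sum of Sibuya random
  sums of signed geometric variables (\<open>SDS_eq_compound\<close>).

  Second, the monadic bind in the mixture is meaningful only if \<open>\<omega> \<mapsto> SDS (\<gamma>'/\<gamma>) (L \<omega>) \<kappa>\<close>, with
  \<open>L \<omega> = l powr (1/\<gamma>) * S \<omega>\<close>, is a measurable kernel at every \<open>\<omega>\<close>, also on the null set where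
  \<open>L \<omega> \<le> 0\<close> (\<open>measurable_SDS\<close>). For positive scale the compound representation gives an explicit
  series in the scale; for negative scale no law exists, so the description has one and the same
  value for all of them.
\<close>

section \<open>Generating functions of integer laws\<close>

text \<open>The real case applied to the real and imaginary parts.\<close>

lemma integral_bind_complex:
  fixes f :: "'b \<Rightarrow> complex"
  assumes M: "prob_space M"
    and N [measurable]: "N \<in> measurable M (subprob_algebra K)"
    and f [measurable]: "f \<in> borel_measurable K"
    and B: "\<And>x. norm (f x) \<le> B"
  shows "integral\<^sup>L (M \<bind> N) f = (\<integral>x. integral\<^sup>L (N x) f \<partial>M)"
proof -
  interpret prob_space M by fact
  have sub: "subprob_space (N x)" if "x \<in> space M" for x
    using measurable_space[OF N that] by (simp add: space_subprob_algebra)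
  have setsN: "sets (N x) = sets K" if "x \<in> space M" for x
    using measurable_space[OF N that] by (simp add: space_subprob_algebra)
  have B0: "0 \<le> B" using B[of undefined] norm_ge_zero[of "f undefined"] by linarith
  have ibl: "integrable P f" if "subprob_space P" "sets P = sets K" for P
  proof -
    interpret P: subprob_space P by fact
    show ?thesis
      using that(2) B by (intro P.integrable_const_bound[where B=B]) (auto cong: measurable_cong_sets)
  qed
  have intN: "integrable (N x) f" if "x \<in> space M" for x
    using ibl sub[OF that] setsN[OF that] by blast
  have bnd: "subprob_space (M \<bind> N)"
    by (rule subprob_space_bind[OF prob_space_imp_subprob_space[OF M] N])
  have "integrable (M \<bind> N) f"
    by (rule ibl[OF bnd], rule sets_bind) (auto simp: setsN not_empty)
  note Re1 = integral_Re[OF this] and Im1 = integral_Im[OF this]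
  have leB: "norm (integral\<^sup>L (N x) f) \<le> B" if "x \<in> space M" for x
  proof -
    interpret P: subprob_space "N x" using sub[OF that] .
    have "norm (integral\<^sup>L (N x) f) \<le> (\<integral>y. norm (f y) \<partial>N x)" by (rule integral_norm_bound)
    also have "\<dots> \<le> (\<integral>y. B \<partial>N x)"
      using intN[OF that] B by (intro integral_mono) auto
    also have "\<dots> = B * measure (N x) (space (N x))" by simp
    also have "\<dots> \<le> B * 1" using B0 P.subprob_measure_le_1 by (intro mult_left_mono) auto
    finally show ?thesis by simp
  qed
  have out: "integrable M (\<lambda>x. integral\<^sup>L (N x) f)"
    using leB by (intro integrable_const_bound[where B=B] AE_I2)
      (auto intro: measurable_compose[OF N integral_measurable_subprob_algebra[OF f]])
  have one: "AE x in M. emeasure (N x) (space (N x)) \<le> ennreal 1"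
    using sub by (auto intro!: AE_I2 simp: subprob_space.emeasure_space_le_1)
  have "(\<integral>x. Re (f x) \<partial>(M \<bind> N)) = (\<integral>x. \<integral>y. Re (f y) \<partial>N x \<partial>M)"
    using abs_Re_le_cmod B order_trans
    by (intro integral_bind[where K=K and B=B and B'=1] one N) (auto intro: finite_measure_axioms, blast)
  also have "\<dots> = (\<integral>x. Re (integral\<^sup>L (N x) f) \<partial>M)"
    using intN by (intro Bochner_Integration.integral_cong) auto
  also have "\<dots> = Re (\<integral>x. integral\<^sup>L (N x) f \<partial>M)" by (rule integral_Re[OF out])
  finally have R: "Re (integral\<^sup>L (M \<bind> N) f) = \<dots>" using Re1 by simp
  have "(\<integral>x. Im (f x) \<partial>(M \<bind> N)) = (\<integral>x. \<integral>y. Im (f y) \<partial>N x \<partial>M)"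
    using abs_Im_le_cmod B order_trans
    by (intro integral_bind[where K=K and B=B and B'=1] one N) (auto intro: finite_measure_axioms, blast)
  also have "\<dots> = (\<integral>x. Im (integral\<^sup>L (N x) f) \<partial>M)"
    using intN by (intro Bochner_Integration.integral_cong) auto
  also have "\<dots> = Im (\<integral>x. integral\<^sup>L (N x) f \<partial>M)" by (rule integral_Im[OF out])
  finally show ?thesis using Im1 R by (simp add: complex_eq_iff)
qed

lemma pgf_eq_expectation:
  assumes "norm z = 1"
  shows "pgf p z = measure_pmf.expectation p (\<lambda>k. z powi k)"
proof -
  have 1: "Infinite_Set_Sum.abs_summable_on (\<lambda>k. complex_of_real (pmf p k) * z powi k) UNIV"
  proof (rule abs_summable_on_comparison_test[OF pmf_abs_summable])
    show "norm (complex_of_real (pmf p k) * z powi k) \<le> norm (pmf p k)" for k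
      using assms by (simp add: norm_mult norm_power_int)
  qed
  have "measure_pmf.expectation p (\<lambda>k. z powi k)
      = infsetsum (\<lambda>k. complex_of_real (pmf p k) * z powi k) UNIV"
    unfolding infsetsum_def measure_pmf_eq_density
    by (subst integral_density) (auto simp: scaleR_conv_of_real)
  also have "\<dots> = pgf p z"
    unfolding pgf_def using 1 by (rule infsetsum_infsum)
  finally show ?thesis ..
qed

lemma norm_pgf_le_1:
  assumes "norm z = 1"
  shows "norm (pgf p z) \<le> 1"
proof -
  have "norm (pgf p z) \<le> measure_pmf.expectation p (\<lambda>k. norm (z powi k))"
    unfolding pgf_eq_expectation[OF assms] by (rule integral_norm_bound)
  then show ?thesis using assms by (simp add: norm_power_int)
qed

lemma pgf_bind_pmf:
  assumes "norm z = 1"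
  shows "pgf (bind_pmf p f) z = measure_pmf.expectation p (\<lambda>x. pgf (f x) z)"
  unfolding pgf_eq_expectation[OF assms] measure_pmf_bind using assms
  by (intro integral_bind_complex[where B=1 and K="count_space UNIV"])
     (auto simp: norm_power_int measure_pmf.prob_space_axioms measure_pmf_in_subprob_algebra)

lemma expectation_nat_pmf_sums:
  fixes f :: "nat \<Rightarrow> complex"
  assumes "\<And>n. norm (f n) \<le> B"
  shows "(\<lambda>n. of_real (pmf p n) * f n) sums measure_pmf.expectation p f"
proof -
  have "integrable (measure_pmf p) f"
    using assms by (intro measure_pmf.integrable_const_bound[where B=B]) auto
  then have "integrable (count_space UNIV) (\<lambda>n. pmf p n *\<^sub>R f n)"
    unfolding measure_pmf_eq_density by (subst (asm) integrable_density) auto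
  then have "(\<lambda>n. pmf p n *\<^sub>R f n) sums (\<integral>n. pmf p n *\<^sub>R f n \<partial>count_space UNIV)"
    by (rule sums_integral_count_space_nat)
  also have "(\<integral>n. pmf p n *\<^sub>R f n \<partial>count_space UNIV) = measure_pmf.expectation p f"
    unfolding measure_pmf_eq_density by (subst integral_density) auto
  finally show ?thesis by (simp add: scaleR_conv_of_real)
qed

text \<open>At \<open>z = cis t\<close> the integral is the value at \<open>t\<close> of the characteristic function of the law
  pushed forward to the reals, so Levy's theorem identifies the two push-forwards; the embedding of
  the integers is injective, so nothing is lost by pushing forward.\<close>

lemma int_measure_eqI:
  fixes A B :: "int measure"
  assumes A: "prob_space A" "sets A = UNIV" and B: "prob_space B" "sets B = UNIV"
    and eq: "\<And>z::complex. norm z = 1 \<Longrightarrow> (\<integral>k. z powi k \<partial>A) = (\<integral>k. z powi k \<partial>B)"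
  shows "A = B"
proof -
  have m: "measurable P N = measurable (count_space UNIV) N" if "sets P = UNIV"
    for P :: "int measure" and N :: "'c measure"
    using that by (intro measurable_cong_sets) auto
  define D where "D P = distr P borel real_of_int" for P
  have D: "real_distribution (D P)" if "prob_space P" "sets P = UNIV" for P
  proof -
    have "real_of_int \<in> borel_measurable P" by (simp add: m[OF that(2)])
    then have "prob_space (D P)"
      unfolding D_def by (rule prob_space.prob_space_distr[OF that(1)])
    then show ?thesis
      by (simp add: real_distribution_def real_distribution_axioms_def D_def)
  qed
  have char: "char (D P) t = (\<integral>k. cis t powi k \<partial>P)" if "sets P = UNIV" for P t
  proof -
    have "real_of_int \<in> borel_measurable P" by (simp add: m[OF that])
    moreover have "iexp (t * real_of_int k) = cis t powi k" for k
      unfolding cis_power_int unfolding cis_conv_exp by (simp add: mult.commute)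
    ultimately show ?thesis
      unfolding char_def D_def by (subst integral_distr) simp_all
  qed
  have "char (D A) = char (D B)"
    by (rule ext) (simp add: char A B eq)
  then have *: "D A = D B"
    by (intro Levy_uniqueness D A B)
  have em: "emeasure P X = emeasure (D P) (real_of_int ` X)" if "sets P = UNIV" for P X
  proof -
    have "real_of_int ` X \<in> sets borel"
      by (rule sets.countable[OF _ countable_image[OF countableI_type]]) simp
    moreover have "real_of_int -` real_of_int ` X = X" by auto
    moreover have "space P = UNIV" using sets_eq_imp_space_eq[of P "count_space UNIV"] that by simp
    moreover have "real_of_int \<in> borel_measurable P" by (simp add: m[OF that])
    ultimately show ?thesis
      unfolding D_def by (simp add: emeasure_distr)
  qed
  show ?thesis
    by (rule measure_eqI) (simp_all add: A B em *)
qed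

lemma pgf_eqI:
  assumes "\<And>z. norm z = 1 \<Longrightarrow> pgf p z = pgf q z"
  shows "p = q"
proof -
  have "measure_pmf p = measure_pmf q"
    using assms
    by (intro int_measure_eqI) (auto simp: pgf_eq_expectation measure_pmf.prob_space_axioms)
  then show ?thesis by (simp add: measure_pmf_inject)
qed

section \<open>Random sums\<close>

fun iid_sum_pmf :: "int pmf \<Rightarrow> nat \<Rightarrow> int pmf" where
  "iid_sum_pmf q 0 = return_pmf 0"
| "iid_sum_pmf q (Suc n) = bind_pmf q (\<lambda>k. map_pmf ((+) k) (iid_sum_pmf q n))"

lemma pgf_iid_sum_pmf:
  assumes "norm z = 1"
  shows "pgf (iid_sum_pmf q n) z = pgf q z ^ n"
proof (induction n)
  case 0
  then show ?case by (simp add: pgf_eq_expectation[OF assms])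
next
  case (Suc n)
  have [simp]: "z \<noteq> 0" using assms by auto
  have shift: "pgf (map_pmf ((+) k) p) z = z powi k * pgf p z" for k p
    by (simp add: pgf_eq_expectation[OF assms] power_int_add)
  show ?case
    by (simp add: pgf_bind_pmf[OF assms] shift Suc) (simp add: pgf_eq_expectation[OF assms])
qed

definition compound_pmf :: "nat pmf \<Rightarrow> int pmf \<Rightarrow> int pmf" where
  "compound_pmf N q = bind_pmf N (iid_sum_pmf q)"

text \<open>The generating function of a random sum is the composition of the generating function of the
  number of summands with that of a summand; it appears as a series because \<open>pgf\<close> is reserved for
  laws on the integers.\<close>

lemma pgf_compound_pmf_sums:
  assumes "norm z = 1"
  shows "(\<lambda>n. of_real (pmf N n) * pgf q z ^ n) sums pgf (compound_pmf N q) z"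
  unfolding compound_pmf_def pgf_bind_pmf[OF assms] pgf_iid_sum_pmf[OF assms]
  using norm_pgf_le_1[OF assms, of q]
  by (intro expectation_nat_pmf_sums[where B=1]) (simp add: norm_power power_le_one)

lemma pgf_compound_poisson:
  assumes "0 < l" "norm z = 1"
  shows "pgf (compound_pmf (poisson_pmf l) q) z = exp (- of_real l * (1 - pgf q z))"
proof -
  let ?w = "of_real l * pgf q z"
  have "(\<lambda>n. of_real (exp (- l)) * (?w ^ n /\<^sub>R fact n)) sums (of_real (exp (- l)) * exp ?w)"
    by (intro sums_mult exp_converges)
  moreover have "of_real (pmf (poisson_pmf l) n) * pgf q z ^ n
      = of_real (exp (- l)) * (?w ^ n /\<^sub>R fact n)" for n
    using assms by (simp add: scaleR_conv_of_real power_mult_distrib divide_simps)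
  ultimately have "pgf (compound_pmf (poisson_pmf l) q) z = of_real (exp (- l)) * exp ?w"
    using pgf_compound_pmf_sums[OF assms(2), of "poisson_pmf l" q] sums_unique2 by simp
  also have "\<dots> = exp (- of_real l * (1 - pgf q z))"
    by (simp add: exp_of_real[symmetric] exp_add[symmetric] algebra_simps)
  finally show ?thesis .
qed

section \<open>The Sibuya law\<close>

text \<open>The coefficients of \<open>1 - (1 - x) powr \<gamma>\<close>.\<close>

definition sibuya_coeff :: "real \<Rightarrow> nat \<Rightarrow> real" where
  "sibuya_coeff \<gamma> n = (if n = 0 then 0 else - ((-1) ^ n * (\<gamma> gchoose n)))"

text \<open>For \<open>n = m + 1\<close> the coefficient is \<open>\<gamma> (1 - \<gamma>) (2 - \<gamma>) ... (m - \<gamma>) / n!\<close>. This is where \<open>\<gamma> \<le> 1\<close>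
  matters.\<close>

lemma sibuya_coeff_nonneg:
  assumes "0 < \<gamma>" "\<gamma> \<le> 1"
  shows "0 \<le> sibuya_coeff \<gamma> n"
proof (cases n)
  case (Suc m)
  have "0 \<le> pochhammer (1 - \<gamma>) m"
    unfolding pochhammer_prod using assms by (intro prod_nonneg) auto
  moreover have "sibuya_coeff \<gamma> n = \<gamma> * pochhammer (1 - \<gamma>) m / fact n"
    using Suc by (simp add: sibuya_coeff_def gbinomial_pochhammer pochhammer_rec
        power_mult_distrib[symmetric] mult.assoc[symmetric] del: power_Suc)
  ultimately show ?thesis using assms by simp
qed (simp add: sibuya_coeff_def)

lemma sibuya_coeff_sums_interior:
  assumes "\<bar>x\<bar> < 1"
  shows "(\<lambda>n. sibuya_coeff \<gamma> n * x ^ n) sums (1 - (1 - x) powr \<gamma>)"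
proof -
  have "(\<lambda>n. (if n = 0 then 1 else 0) - (\<gamma> gchoose n) * (- x) ^ n) sums (1 - (1 + - x) powr \<gamma>)"
    using assms by (intro sums_diff sums_single[of 0 "\<lambda>_. 1::real"] gen_binomial_real) simp
  moreover have "(if n = 0 then 1 else 0) - (\<gamma> gchoose n) * (- x) ^ n = sibuya_coeff \<gamma> n * x ^ n" for n
    by (simp add: sibuya_coeff_def power_minus[of x])
  ultimately show ?thesis by simp
qed

text \<open>Each partial sum is the limit, as \<open>x\<close> increases to 1, of a partial sum of a series of
  nonnegative terms whose value \<open>1 - (1 - x) powr \<gamma>\<close> is at most 1.\<close>

lemma summable_sibuya_coeff:
  assumes "0 < \<gamma>" "\<gamma> \<le> 1"
  shows "summable (sibuya_coeff \<gamma>)"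
proof (rule summableI_nonneg_bounded)
  note nn = sibuya_coeff_nonneg[OF assms]
  show "0 \<le> sibuya_coeff \<gamma> n" for n by (rule nn)
  fix N
  have le: "(\<Sum>n<N. sibuya_coeff \<gamma> n * x ^ n) \<le> 1" if "0 < x" "x < 1" for x
  proof -
    have s: "(\<lambda>n. sibuya_coeff \<gamma> n * x ^ n) sums (1 - (1 - x) powr \<gamma>)"
      using that by (intro sibuya_coeff_sums_interior) auto
    have "(\<Sum>n<N. sibuya_coeff \<gamma> n * x ^ n) \<le> (\<Sum>n. sibuya_coeff \<gamma> n * x ^ n)"
      using that nn by (intro sum_le_suminf sums_summable[OF s]) auto
    also have "\<dots> = 1 - (1 - x) powr \<gamma>" using s by (simp add: sums_iff)
    finally show ?thesis using powr_ge_zero[of "1 - x" \<gamma>] by linarith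
  qed
  have "((\<lambda>x. \<Sum>n<N. sibuya_coeff \<gamma> n * x ^ n) \<longlongrightarrow> (\<Sum>n<N. sibuya_coeff \<gamma> n * 1 ^ n)) (at_left 1)"
    by (intro tendsto_intros)
  moreover have "\<forall>\<^sub>F x in at_left 1. x \<in> {0<..<1::real}"
    by (rule eventually_at_left_real) simp
  then have "\<forall>\<^sub>F x in at_left 1. (\<Sum>n<N. sibuya_coeff \<gamma> n * x ^ n) \<le> 1"
    by eventually_elim (auto intro: le)
  ultimately have "(\<Sum>n<N. sibuya_coeff \<gamma> n * 1 ^ n) \<le> 1"
    by (rule tendsto_upperbound) simp
  then show "(\<Sum>n<N. sibuya_coeff \<gamma> n) \<le> 1" by simp
qed

text \<open>The binomial series covers only the open interval, but the endpoints are attained: \<open>\<phi>(1) = 1\<close>,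
  and \<open>\<phi>(-1) = -1\<close> for \<open>\<kappa> = 0\<close>. Summability of the coefficients makes the series converge uniformly
  on the closed interval, so the identity extends by continuity.\<close>

lemma sibuya_coeff_sums:
  assumes \<gamma>: "0 < \<gamma>" "\<gamma> \<le> 1" and x: "x \<in> {-1..1}"
  shows "(\<lambda>n. sibuya_coeff \<gamma> n * x ^ n) sums (1 - (1 - x) powr \<gamma>)"
proof -
  let ?b = "sibuya_coeff \<gamma>"
  have bound: "norm (?b n * y ^ n) \<le> ?b n" if "y \<in> {-1..1}" for n and y :: real
  proof -
    have "\<bar>y\<bar> ^ n \<le> 1" using that by (intro power_le_one) auto
    then show ?thesis
      using sibuya_coeff_nonneg[OF \<gamma>, of n] by (simp add: abs_mult power_abs mult_left_le)
  qed
  have "uniform_limit {-1..1} (\<lambda>n y. \<Sum>i<n. ?b i * y ^ i) (\<lambda>y. \<Sum>i. ?b i * y ^ i) sequentially"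
    using bound summable_sibuya_coeff[OF \<gamma>] by (intro Weierstrass_m_test) auto
  then have "continuous_on {-1..1} (\<lambda>y. \<Sum>i. ?b i * y ^ i)"
    by (rule uniform_limit_theorem[rotated]) (auto intro!: continuous_intros always_eventually)
  moreover define g where "g y = (\<Sum>i. ?b i * y ^ i) - (1 - (1 - y) powr \<gamma>)" for y
  ultimately have "continuous_on {-1..1} g"
    using \<gamma> unfolding g_def by (auto intro!: continuous_intros continuous_on_powr')
  then have cont: "continuous_on (closure {-1<..<1}) g" by simp
  have int: "g y = 0" if "y \<in> {-1<..<1}" for y
  proof -
    have "\<bar>y\<bar> < 1" using that by auto
    from sums_unique[OF sibuya_coeff_sums_interior[OF this]] show ?thesis by (simp add: g_def)
  qed
  have "g x = 0"
    by (rule continuous_constant_on_closure[OF cont int]) (use x in simp_all)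
  moreover have "summable (\<lambda>n. ?b n * x ^ n)"
    by (rule summable_comparison_test'[OF summable_sibuya_coeff[OF \<gamma>], of 0]) (rule bound[OF x])
  ultimately show ?thesis by (simp add: g_def sums_iff)
qed

definition sibuya_pmf :: "real \<Rightarrow> nat pmf" where
  "sibuya_pmf \<gamma> = embed_pmf (sibuya_coeff \<gamma>)"

lemma pmf_sibuya:
  assumes "0 < \<gamma>" "\<gamma> \<le> 1"
  shows "pmf (sibuya_pmf \<gamma>) n = sibuya_coeff \<gamma> n"
  unfolding sibuya_pmf_def
proof (rule pmf_embed_pmf[OF sibuya_coeff_nonneg[OF assms]])
  have "sibuya_coeff \<gamma> sums 1"
    using sibuya_coeff_sums[OF assms, of 1] assms by simp
  then show "(\<integral>\<^sup>+n. ennreal (sibuya_coeff \<gamma> n) \<partial>count_space UNIV) = 1"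
    unfolding nn_integral_count_space_nat
    using sibuya_coeff_nonneg[OF assms] by (subst suminf_ennreal_eq) auto
qed

lemma pgf_compound_sibuya:
  assumes "0 < \<gamma>" "\<gamma> \<le> 1" "norm z = 1" and q: "pgf q z = of_real x"
  shows "pgf (compound_pmf (sibuya_pmf \<gamma>) q) z = of_real (1 - (1 - x) powr \<gamma>)"
proof -
  have "\<bar>x\<bar> \<le> 1" using norm_pgf_le_1[OF assms(3), of q] q by simp
  then have "(\<lambda>n. sibuya_coeff \<gamma> n * x ^ n) sums (1 - (1 - x) powr \<gamma>)"
    using assms by (intro sibuya_coeff_sums) auto
  then have "(\<lambda>n. complex_of_real (sibuya_coeff \<gamma> n * x ^ n)) sums of_real (1 - (1 - x) powr \<gamma>)"
    by (subst sums_of_real_iff)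
  then show ?thesis
    using pgf_compound_pmf_sums[OF assms(3), of "sibuya_pmf \<gamma>" q] sums_unique2
    by (simp add: pmf_sibuya assms)
qed

section \<open>The signed geometric law\<close>

definition sym_geometric_pmf :: "real \<Rightarrow> int pmf" where
  "sym_geometric_pmf \<kappa> = bind_pmf (bernoulli_pmf (1/2))
     (\<lambda>b. let p = map_pmf (\<lambda>n. int n + 1) (geometric_pmf (1 - \<kappa>)) in if b then p else map_pmf uminus p)"

lemma pgf_shifted_geometric:
  assumes "0 \<le> \<kappa>" "\<kappa> < 1" "norm z = 1"
  shows "pgf (map_pmf (\<lambda>n. int n + 1) (geometric_pmf (1 - \<kappa>))) z
    = of_real (1 - \<kappa>) * (z / (1 - of_real \<kappa> * z))"
proof -
  let ?g = "geometric_pmf (1 - \<kappa>)"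
  have z: "z \<noteq> 0" using assms by auto
  have "(\<lambda>n. of_real (pmf ?g n) * (z ^ n * z)) sums measure_pmf.expectation ?g (\<lambda>n. z ^ n * z)"
    using assms by (intro expectation_nat_pmf_sums[where B=1]) (simp add: norm_mult norm_power)
  moreover have "(\<lambda>n. (of_real (1 - \<kappa>) * z) * (of_real \<kappa> * z) ^ n) sums
      ((of_real (1 - \<kappa>) * z) * (1 / (1 - of_real \<kappa> * z)))"
    using assms by (intro sums_mult geometric_sums) (simp add: norm_mult)
  moreover have "of_real (pmf ?g n) * (z ^ n * z) = (of_real (1 - \<kappa>) * z) * (of_real \<kappa> * z) ^ n" for n
    using assms by (simp add: power_mult_distrib)
  ultimately have "measure_pmf.expectation ?g (\<lambda>n. z ^ n * z) =
      (of_real (1 - \<kappa>) * z) * (1 / (1 - of_real \<kappa> * z))"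
    using sums_unique2 by simp
  then show ?thesis
    using z by (simp add: pgf_eq_expectation[OF assms(3)] power_int_add)
qed

lemma pgf_sym_geometric:
  assumes "0 \<le> \<kappa>" "\<kappa> < 1" "norm z = 1"
  shows "pgf (sym_geometric_pmf \<kappa>) z = of_real ((1 - \<kappa>) / 2) *
    (z / (1 - of_real \<kappa> * z) + inverse z / (1 - of_real \<kappa> * inverse z))"
proof -
  have neg: "pgf (map_pmf uminus p) z = pgf p (inverse z)" for p
    using assms by (simp add: pgf_eq_expectation norm_inverse power_int_minus power_int_inverse)
  define p where "p = map_pmf (\<lambda>n. int n + 1) (geometric_pmf (1 - \<kappa>))"
  have "pgf (sym_geometric_pmf \<kappa>) z = (pgf p z + pgf p (inverse z)) / 2"
    unfolding sym_geometric_pmf_def pgf_bind_pmf[OF assms(3)] Let_def p_def[symmetric]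
    by (subst integral_measure_pmf[of UNIV])
       (simp_all add: UNIV_bool neg scaleR_conv_of_real add.commute add_divide_distrib)
  moreover have "pgf p z = of_real (1 - \<kappa>) * (z / (1 - of_real \<kappa> * z))"
    "pgf p (inverse z) = of_real (1 - \<kappa>) * (inverse z / (1 - of_real \<kappa> * inverse z))"
    unfolding p_def using assms by (intro pgf_shifted_geometric; simp add: norm_inverse)+
  moreover have "(of_real c * a + of_real c * b) / 2 = of_real (c / 2) * (a + b)"
    for c and a b :: complex
    by (simp add: algebra_simps)
  ultimately show ?thesis by (simp only:)
qed

text \<open>On the unit circle inversion is conjugation, and it exchanges the two halves of the function.\<close>

lemma pgf_sym_geometric_real:
  assumes "0 \<le> \<kappa>" "\<kappa> < 1" "norm z = 1"
  obtains x where "pgf (sym_geometric_pmf \<kappa>) z = of_real x" "x \<le> 1"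
proof -
  have "z * cnj z = 1"
    using assms complex_norm_square[of z] by simp
  then have "inverse z = cnj z" by (rule inverse_unique)
  then have "cnj (pgf (sym_geometric_pmf \<kappa>) z) = pgf (sym_geometric_pmf \<kappa>) z"
    using assms by (simp add: pgf_sym_geometric add.commute)
  then have "pgf (sym_geometric_pmf \<kappa>) z = of_real (Re (pgf (sym_geometric_pmf \<kappa>) z))"
    by (simp add: complex_eq_iff)
  moreover have "Re (pgf (sym_geometric_pmf \<kappa>) z) \<le> 1"
    using norm_pgf_le_1[OF assms(3)] complex_Re_le_cmod order_trans by blast
  ultimately show thesis by (rule that)
qed

section \<open>Symmetric discrete stable laws\<close>

text \<open>Since \<open>1 - x\<close> is nonnegative, the principal complex power is the real one.\<close>

lemma SDS_gf_of_real:
  assumes "0 \<le> \<kappa>" "\<kappa> < 1" "norm z = 1"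
    and "pgf (sym_geometric_pmf \<kappa>) z = of_real x" "x \<le> 1"
  shows "SDS_gf \<gamma> l \<kappa> z = of_real (exp (- l * (1 - x) powr \<gamma>))"
proof -
  have "(1 - complex_of_real x) powr of_real \<gamma> = of_real ((1 - x) powr \<gamma>)"
    using powr_of_real[of "1 - x" \<gamma>] assms by simp
  then show ?thesis
    unfolding SDS_gf_def pgf_sym_geometric[OF assms(1-3), symmetric] assms(4)
    by (simp add: exp_of_real[symmetric])
qed

lemma pgf_compound_poisson_sibuya:
  assumes "0 < \<gamma>" "\<gamma> \<le> 1" "0 < l" "0 \<le> \<kappa>" "\<kappa> < 1" "norm z = 1"
  shows "pgf (compound_pmf (poisson_pmf l) (compound_pmf (sibuya_pmf \<gamma>) (sym_geometric_pmf \<kappa>))) z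
    = SDS_gf \<gamma> l \<kappa> z"
proof -
  obtain x where x: "pgf (sym_geometric_pmf \<kappa>) z = of_real x" "x \<le> 1"
    using pgf_sym_geometric_real assms by metis
  show ?thesis
    using assms by (simp add: pgf_compound_poisson pgf_compound_sibuya[OF _ _ _ x(1)]
        SDS_gf_of_real[OF _ _ _ x] exp_of_real[symmetric])
qed

lemma SDS_eq_compound:
  assumes "0 < \<gamma>" "\<gamma> \<le> 1" "0 < l" "0 \<le> \<kappa>" "\<kappa> < 1"
  shows "SDS \<gamma> l \<kappa> =
    compound_pmf (poisson_pmf l) (compound_pmf (sibuya_pmf \<gamma>) (sym_geometric_pmf \<kappa>))"
  unfolding SDS_def
  by (rule the_equality) (auto intro!: pgf_eqI simp: pgf_compound_poisson_sibuya[OF assms])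

lemma pgf_SDS:
  assumes "0 < \<gamma>" "\<gamma> \<le> 1" "0 < l" "0 \<le> \<kappa>" "\<kappa> < 1" "norm z = 1"
  shows "pgf (SDS \<gamma> l \<kappa>) z = SDS_gf \<gamma> l \<kappa> z"
  by (simp add: SDS_eq_compound pgf_compound_poisson_sibuya assms)

text \<open>For negative \<open>l\<close> the prescribed function exceeds 1 in modulus at \<open>z = -1\<close>, so it is no
  generating function. The value of the description is unspecified, but it does not depend on \<open>l\<close>,
  which is what measurability in the scale requires.\<close>

lemma SDS_negative_scale:
  assumes "0 \<le> \<kappa>" "\<kappa> < 1" "l < 0"
  shows "SDS \<gamma> l \<kappa> = (THE p. False)"
proof -
  have "\<not> (\<forall>z. norm z = 1 \<longrightarrow> pgf p z = SDS_gf \<gamma> l \<kappa> z)" for p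
  proof
    assume *: "\<forall>z. norm z = 1 \<longrightarrow> pgf p z = SDS_gf \<gamma> l \<kappa> z"
    \<comment> \<open>the value of \<open>\<phi>\<close> at \<open>-1\<close>\<close>
    let ?x = "- ((1 - \<kappa>) / (1 + \<kappa>))"
    have x: "?x \<le> 0" using assms by simp
    then have x1: "?x \<le> 1" by linarith
    have "1 + complex_of_real \<kappa> \<noteq> 0" "2 + 2 * complex_of_real \<kappa> \<noteq> 0"
      using assms by (auto simp: complex_eq_iff)
    then have "pgf (sym_geometric_pmf \<kappa>) (-1) = of_real ?x"
      using assms by (simp add: pgf_sym_geometric divide_simps) (simp add: algebra_simps)
    then have "SDS_gf \<gamma> l \<kappa> (-1) = of_real (exp (- l * (1 - ?x) powr \<gamma>))"
      by (intro SDS_gf_of_real[OF assms(1,2) _ _ x1]) simp_all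
    moreover have "1 < exp (- l * (1 - ?x) powr \<gamma>)"
    proof -
      have "0 < (1 - ?x) powr \<gamma>" using x unfolding powr_gt_zero by linarith
      then have "0 < - l * (1 - ?x) powr \<gamma>" using assms by (intro mult_pos_pos) auto
      then show ?thesis by (simp only: one_less_exp_iff)
    qed
    ultimately have "1 < norm (SDS_gf \<gamma> l \<kappa> (-1))" by simp
    then show False using * norm_pgf_le_1[of "-1" p] by auto
  qed
  then have "(\<lambda>p. \<forall>z. norm z = 1 \<longrightarrow> pgf p z = SDS_gf \<gamma> l \<kappa> z) = (\<lambda>p. False)"
    by (intro ext) blast
  then show ?thesis unfolding SDS_def by (rule arg_cong)
qed

text \<open>Each probability is, as a function of the scale, a convergent series of continuous functions
  on the positive half-line and constant on the negative one. The single point 0 cannot spoil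
  measurability, whatever the law there is.\<close>

lemma measurable_SDS:
  assumes "0 < \<gamma>" "\<gamma> \<le> 1" "0 \<le> \<kappa>" "\<kappa> < 1" and L [measurable]: "L \<in> borel_measurable M"
  shows "(\<lambda>\<omega>. measure_pmf (SDS \<gamma> (L \<omega>) \<kappa>)) \<in> measurable M (subprob_algebra (count_space UNIV))"
proof (rule measurable_subprob_algebra)
  fix X :: "int set"
  let ?q = "compound_pmf (sibuya_pmf \<gamma>) (sym_geometric_pmf \<kappa>)"
  let ?c = "\<lambda>n. emeasure (measure_pmf (iid_sum_pmf ?q n)) X"
  have pos: "emeasure (SDS \<gamma> l \<kappa>) X = (\<Sum>n. ennreal (l ^ n / fact n * exp (- l)) * ?c n)"
    if "0 < l" for l
  proof -
    have "emeasure (SDS \<gamma> l \<kappa>) X = (\<integral>\<^sup>+n. ?c n \<partial>poisson_pmf l)"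
      using assms that by (simp add: SDS_eq_compound compound_pmf_def[of "poisson_pmf l"])
    also have "\<dots> = (\<integral>\<^sup>+n. ennreal (pmf (poisson_pmf l) n) * ?c n \<partial>count_space UNIV)"
      by (rule nn_integral_measure_pmf)
    finally show ?thesis using that by (simp add: nn_integral_count_space_nat)
  qed
  let ?h = "\<lambda>l::real. if 0 < l then \<Sum>n. ennreal (l ^ n / fact n * exp (- l)) * ?c n
    else if l = 0 then emeasure (SDS \<gamma> 0 \<kappa>) X else emeasure (measure_pmf (THE p. False)) X"
  have "emeasure (SDS \<gamma> l \<kappa>) X = ?h l" for l
    using pos SDS_negative_scale[OF assms(3,4), of l \<gamma>] by auto
  then have "(\<lambda>\<omega>. emeasure (SDS \<gamma> (L \<omega>) \<kappa>) X) = (\<lambda>\<omega>. ?h (L \<omega>))"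
    by (intro ext)
  moreover have "(\<lambda>\<omega>. ?h (L \<omega>)) \<in> borel_measurable M"
    by measurable
  ultimately show "(\<lambda>\<omega>. emeasure (SDS \<gamma> (L \<omega>) \<kappa>) X) \<in> borel_measurable M"
    by metis
qed (auto simp: measure_pmf.subprob_space_axioms)

section \<open>Mixing over a stable scale\<close>

theorem theorem5p2:
  fixes \<gamma> \<gamma>' l \<kappa> :: real and M :: "'a measure" and S :: "'a \<Rightarrow> real"
  assumes "0 < \<gamma>" "\<gamma> \<le> 1" "0 < \<gamma>'" "\<gamma>' \<le> 1" "\<gamma>' \<le> \<gamma>"
    and "0 < l" and "0 \<le> \<kappa>" "\<kappa> < 1"
    and "prob_space M" and "S \<in> borel_measurable M" and "AE \<omega> in M. 0 < S \<omega>"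
    and laplace: "\<And>u. 0 \<le> u \<Longrightarrow> (LINT \<omega>|M. exp (- u * S \<omega>)) = exp (- (u powr \<gamma>))"
  shows "measure_pmf (SDS \<gamma>' l \<kappa>) = SDS_mix M (\<gamma>' / \<gamma>) (\<lambda>\<omega>. l powr (1 / \<gamma>) * S \<omega>) \<kappa>"
proof -
  interpret prob_space M by fact
  note [measurable] = \<open>S \<in> borel_measurable M\<close>
  let ?L = "\<lambda>\<omega>. l powr (1 / \<gamma>) * S \<omega>" and ?r = "\<gamma>' / \<gamma>"
  have r: "0 < ?r" "?r \<le> 1" using assms by auto
  have N: "(\<lambda>\<omega>. measure_pmf (SDS ?r (?L \<omega>) \<kappa>)) \<in> measurable M (subprob_algebra (count_space UNIV))"
    by (rule measurable_SDS) (use assms r in auto)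
  show ?thesis
    unfolding SDS_mix_def
  proof (rule int_measure_eqI)
    show "prob_space (M \<bind> (\<lambda>\<omega>. measure_pmf (SDS ?r (?L \<omega>) \<kappa>)))"
      by (rule prob_space_bind[OF _ N]) (simp add: measure_pmf.prob_space_axioms)
    show "sets (M \<bind> (\<lambda>\<omega>. measure_pmf (SDS ?r (?L \<omega>) \<kappa>))) = UNIV"
      using sets_bind[of M _ "count_space (UNIV :: int set)"] not_empty by simp
    fix z :: complex assume z: "norm z = 1"
    obtain x where x: "pgf (sym_geometric_pmf \<kappa>) z = of_real x" "x \<le> 1"
      using pgf_sym_geometric_real assms z by metis
    have gf: "pgf (SDS g s \<kappa>) z = of_real (exp (- s * (1 - x) powr g))"
      if "0 < g" "g \<le> 1" "0 < s" for g s
      using that assms z x by (simp add: pgf_SDS SDS_gf_of_real)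
    let ?u = "l powr (1 / \<gamma>) * (1 - x) powr ?r"
    have m: "(\<lambda>\<omega>. pgf (SDS ?r (?L \<omega>) \<kappa>) z) \<in> borel_measurable M"
      unfolding pgf_eq_expectation[OF z]
      by (rule measurable_compose[OF N integral_measurable_subprob_algebra]) simp
    have "(\<integral>k. z powi k \<partial>(M \<bind> (\<lambda>\<omega>. measure_pmf (SDS ?r (?L \<omega>) \<kappa>))))
        = (\<integral>\<omega>. pgf (SDS ?r (?L \<omega>) \<kappa>) z \<partial>M)"
      unfolding pgf_eq_expectation[OF z]
      by (rule integral_bind_complex[OF prob_space_axioms N, where B=1])
        (auto simp: norm_power_int z)
    also have "\<dots> = (\<integral>\<omega>. complex_of_real (exp (- ?u * S \<omega>)) \<partial>M)"
    proof (rule integral_cong_AE)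
      show "AE \<omega> in M. pgf (SDS ?r (?L \<omega>) \<kappa>) z = complex_of_real (exp (- ?u * S \<omega>))"
        using \<open>AE \<omega> in M. 0 < S \<omega>\<close>
        by eventually_elim (use assms r in \<open>simp add: gf mult_ac\<close>)
    qed (use m in auto)
    also have "\<dots> = of_real (exp (- (?u powr \<gamma>)))"
      using laplace[of ?u] by simp
    also have "?u powr \<gamma> = l * (1 - x) powr \<gamma>'"
      using assms x by (simp add: powr_mult powr_powr)
    also have "complex_of_real (exp (- (l * (1 - x) powr \<gamma>'))) = pgf (SDS \<gamma>' l \<kappa>) z"
      using assms by (simp add: gf)
    finally show "(\<integral>k. z powi k \<partial>SDS \<gamma>' l \<kappa>)
        = (\<integral>k. z powi k \<partial>(M \<bind> (\<lambda>\<omega>. measure_pmf (SDS ?r (?L \<omega>) \<kappa>))))"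
      by (simp add: pgf_eq_expectation[OF z])
  qed (simp_all add: measure_pmf.prob_space_axioms)
qed

end
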